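(* Let $(a_k)_{k\ge 0}$ be an arbitrary sequence (not necessarily periodic) with $a_k\in\{-1,+1\}$ for all $k\ge 0$. Then the continued radical $$a_0\sqrt{2+a_1\sqrt{2+a_2\sqrt{2+a_3\sqrt{2+\cdots}}}}$$ converges, i.e. the sequence of its truncations $$x_n = a_0\sqrt{2+a_1\sqrt{2+a_2\sqrt{2+\cdots+a_{n-1}\sqrt{2}}}},\qquad n\ge 1,$$ converges to a real number $x$ as $n\to\infty$, and $$x = -2\cos(Q\pi),\qquad\text{where}\quad Q=\sum_{m=0}^\infty \frac{Q_m}{2^{m+1}},\quad Q_m=\frac{1+P_m}{2},\quad P_m=\prod_{k=0}^m a_k .$$
   Context: The truncation $x_n$ of the continued radical is defined as follows: for $n\ge 1$ set $r_{n,n-1}=a_{n-1}\sqrt{2}$ and $r_{n,k}=a_k\sqrt{2+r_{n,k+1}}$ for $k=n-2,n-3,\dots,0$ (real nonnegative square roots); then $x_n=r_{n,0}$. For instance $x_1=a_0\sqrt2$ and $x_2=a_0\sqrt{2+a_1\sqrt2}$. The value (limit) of the continued radical means $\lim_{n\to\infty}x_n$. Since $P_m\in\{-1,1\}$, each $Q_m\in\{0,1\}$, so $Q\in[0,1]$ is the real number with binary expansion $0.Q_0Q_1Q_2\cdots$. *)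

theory Defs
  imports "HOL-Analysis.Analysis"
begin

(* The tails r_{n,k} of the n-th truncation, computed from the innermost radical
   k = n - 1 outwards.  Only the values with k < n are meaningful; for k >= n the
   function takes the junk value a k * sqrt 2. *)
function radical_tail :: "(nat \<Rightarrow> real) \<Rightarrow> nat \<Rightarrow> nat \<Rightarrow> real" where
  "radical_tail a n k =
     (if Suc k < n then a k * sqrt (2 + radical_tail a n (Suc k)) else a k * sqrt 2)"
  by pat_completeness auto
termination
  by (relation "Wellfounded.measure (\<lambda>(a, n, k). n - k)") auto

declare radical_tail.simps [simp del]

(* x_n for n >= 1; the index n = 0 carries a junk value. *)
definition radical_truncation :: "(nat \<Rightarrow> real) \<Rightarrow> nat \<Rightarrow> real" where
  "radical_truncation a n = radical_tail a n 0"

definition sign_product :: "(nat \<Rightarrow> real) \<Rightarrow> nat \<Rightarrow> real" where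
  "sign_product a m = (\<Prod>k=0..m. a k)"

definition binary_digit :: "(nat \<Rightarrow> real) \<Rightarrow> nat \<Rightarrow> real" where
  "binary_digit a m = (1 + sign_product a m) / 2"

definition binary_expansion :: "(nat \<Rightarrow> real) \<Rightarrow> real" where
  "binary_expansion a = (\<Sum>m. binary_digit a m / 2 ^ (m + 1))"

(* The library's sqrt is odd, hence negative on negative arguments.  The next lemma shows
   that every radicand 2 + r_{n,k+1} is nonnegative, so that case never arises. *)
lemma abs_radical_tail_le:
  assumes a: "\<And>k. a k \<in> {-1, 1}"
  shows "\<bar>radical_tail a n k\<bar> \<le> 2"
proof (induction "n - k" arbitrary: k rule: less_induct)
  case less
  have abs_a: "\<bar>a k\<bar> = 1" using a[of k] by auto
  have sqrt_le: "\<bar>sqrt y\<bar> \<le> 2" if "0 \<le> y" "y \<le> 4" for y :: real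
    using that real_sqrt_le_mono[of y 4] by simp
  show ?case
  proof (cases "Suc k < n")
    case True
    have "\<bar>radical_tail a n (Suc k)\<bar> \<le> 2" using True by (intro less) auto
    then have "\<bar>sqrt (2 + radical_tail a n (Suc k))\<bar> \<le> 2" by (intro sqrt_le) auto
    then show ?thesis
      using True abs_a by (subst radical_tail.simps) (simp add: abs_mult)
  next
    case False
    then show ?thesis
      using abs_a sqrt_le[of 2] by (subst radical_tail.simps) (simp add: abs_mult)
  qed
qed

lemma summable_binary_expansion:
  assumes a: "\<And>k. a k \<in> {-1, 1}"
  shows "summable (\<lambda>m. binary_digit a m / 2 ^ (m + 1))"
proof (rule summable_comparison_test')
  show "summable (\<lambda>m. (1 / 2 :: real) ^ m)" by (rule summable_geometric) simp
next
  fix m :: nat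
  have "\<bar>a k\<bar> = 1" for k using a[of k] by auto
  then have "\<bar>sign_product a m\<bar> = 1"
    unfolding sign_product_def by (simp add: abs_prod)
  then have "\<bar>binary_digit a m\<bar> \<le> 1" unfolding binary_digit_def by auto
  then show "norm (binary_digit a m / 2 ^ (m + 1)) \<le> (1 / 2) ^ m"
    by (simp add: power_one_over field_simps)
qed

end

(* Since 2 + 2 sin t = 4 sin^2 (pi/4 + t/2), a tail 2 sin t with |t| <= pi/2 turns into
   2 sin (a (pi/4 + t/2)) under one more radical with sign a.  So x_n = 2 sin (pi/4 * S_n) with
   S_n = P_0 + P_1/2 + ... + P_(n-1)/2^(n-1), and S_n tends to 4 Q - 2. *)
theory Submission
  imports Defs
begin

text \<open>The start index \<open>k\<close> is free because removing the outermost radical shifts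
  it by one; \<open>d\<close> counts the radicals kept.\<close>

definition signed_sum :: "(nat \<Rightarrow> real) \<Rightarrow> nat \<Rightarrow> nat \<Rightarrow> real" where
  "signed_sum a k d = (\<Sum>j<d. (\<Prod>i\<le>j. a (k + i)) / 2 ^ j)"

text \<open>All products share the factor \<open>a k\<close>. Scaled by pi/4, this is the angle map
  that one more radical induces.\<close>

lemma signed_sum_Suc:
  "signed_sum a k (Suc d) = a k * (1 + signed_sum a (Suc k) d / 2)"
proof -
  have "signed_sum a k (Suc d) = a k + (\<Sum>j<d. (\<Prod>i\<le>Suc j. a (k + i)) / 2 ^ Suc j)"
    unfolding signed_sum_def by (subst sum.lessThan_Suc_shift) simp
  also have "(\<Sum>j<d. (\<Prod>i\<le>Suc j. a (k + i)) / 2 ^ Suc j) = a k * (signed_sum a (Suc k) d / 2)"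
    unfolding signed_sum_def sum_distrib_left sum_divide_distrib
    by (intro sum.cong refl, subst prod.atMost_Suc_shift) simp
  finally show ?thesis by (simp add: algebra_simps)
qed

text \<open>The bound 2 is preserved since |1 + s/2| \<le> 2 whenever |s| \<le> 2. It keeps the
  angles within pi/2 of 0.\<close>

lemma abs_signed_sum_le:
  assumes a: "\<And>k. a k \<in> {-1, 1}"
  shows "\<bar>signed_sum a k d\<bar> \<le> 2"
proof (induction d arbitrary: k)
  case 0
  show ?case by (simp add: signed_sum_def)
next
  case (Suc d)
  have "\<bar>a k\<bar> = 1" using a[of k] by auto
  then show ?case
    using Suc[of "Suc k"] by (simp add: signed_sum_Suc abs_mult)
qed

lemma sqrt_two_plus_two_sin:
  fixes t :: real
  assumes "\<bar>t\<bar> \<le> pi / 2"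
  shows "sqrt (2 + 2 * sin t) = 2 * sin (pi / 4 + t / 2)"
proof (rule real_sqrt_unique)
  have "cos (2 * (pi / 4 + t / 2)) = - sin t"
    using minus_sin_cos_eq[of t] by (simp add: algebra_simps)
  then show "(2 * sin (pi / 4 + t / 2))\<^sup>2 = 2 + 2 * sin t"
    using cos_double_sin[of "pi / 4 + t / 2"] by (simp add: power_mult_distrib)
  \<comment> \<open>The bound on \<open>t\<close> puts the new angle in [0, pi/2], so the root is
    the sine itself and not its negative.\<close>
  show "0 \<le> 2 * sin (pi / 4 + t / 2)"
    using assms by (simp add: sin_ge_zero)
qed

text \<open>Induction on the number of radicals with \<open>k\<close> arbitrary: the tail at
  \<open>Suc k\<close> has the same end index and one radical fewer.\<close>

lemma radical_tail_eq_sin: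
  assumes a: "\<And>k. a k \<in> {-1, 1}"
  shows "radical_tail a (k + Suc d) k = 2 * sin (pi / 4 * signed_sum a k (Suc d))"
proof (induction d arbitrary: k)
  case 0
  show ?case
    using a[of k]
    by (subst radical_tail.simps) (auto simp: signed_sum_def sin_45)
next
  case (Suc d)
  let ?S = "signed_sum a (Suc k) (Suc d)"
  let ?t = "pi / 4 * ?S"
  have "\<bar>?t\<bar> \<le> pi / 2"
    using abs_signed_sum_le[of a "Suc k" "Suc d", OF a] by (simp add: abs_mult)
  then have "sqrt (2 + 2 * sin ?t) = 2 * sin (pi / 4 + ?t / 2)"
    by (rule sqrt_two_plus_two_sin)
  then have "radical_tail a (k + Suc (Suc d)) k = a k * (2 * sin (pi / 4 + ?t / 2))"
    using Suc[of "Suc k"] by (subst radical_tail.simps) simp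
  \<comment> \<open>Sine is odd, so the sign moves into the angle.\<close>
  also have "\<dots> = 2 * sin (a k * (pi / 4 + ?t / 2))"
  proof -
    have "a k = 1 \<or> a k = -1" using a[of k] by auto
    then show ?thesis
      by (elim disjE) (simp_all only: mult_1 mult_minus1 sin_minus mult_minus_right)
  qed
  also have "a k * (pi / 4 + ?t / 2) = pi / 4 * signed_sum a k (Suc (Suc d))"
    by (simp add: signed_sum_Suc[of a k "Suc d"] algebra_simps)
  finally show ?case .
qed

text \<open>From P_m = 2 Q_m - 1, each term P_m / 2^m is 4 Q_m / 2^(m+1) minus a geometric term, and
  the latter sum to 2.\<close>

lemma signed_sum_tendsto:
  assumes a: "\<And>k. a k \<in> {-1, 1}"
  shows "signed_sum a 0 \<longlonglongrightarrow> 4 * binary_expansion a - 2"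
proof -
  have "(\<lambda>m. binary_digit a m / 2 ^ (m + 1)) sums binary_expansion a"
    unfolding binary_expansion_def by (rule summable_sums[OF summable_binary_expansion[of a, OF a]])
  moreover have "(\<lambda>m. (1 / 2 :: real) ^ m) sums 2"
    using geometric_sums[of "1 / 2 :: real"] by simp
  ultimately have "(\<lambda>m. 4 * (binary_digit a m / 2 ^ (m + 1)) - (1 / 2) ^ m)
      sums (4 * binary_expansion a - 2)"
    by (intro sums_diff sums_mult)
  moreover have "4 * (binary_digit a m / 2 ^ (m + 1)) - (1 / 2) ^ m
      = (\<Prod>i\<le>m. a (0 + i)) / 2 ^ m" for m
    by (simp add: binary_digit_def sign_product_def atLeast0AtMost power_one_over field_simps)
  ultimately show ?thesis
    unfolding sums_def signed_sum_def by simp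
qed

theorem mainTheorem1:
  fixes a :: "nat \<Rightarrow> real"
  assumes "\<And>k. a k \<in> {-1, 1}"
  shows "radical_truncation a \<longlonglongrightarrow> - 2 * cos (binary_expansion a * pi)"
proof -
  have "(\<lambda>d. 2 * sin (pi / 4 * signed_sum a 0 (Suc d)))
      \<longlonglongrightarrow> 2 * sin (pi / 4 * (4 * binary_expansion a - 2))"
    by (intro tendsto_intros LIMSEQ_Suc[OF signed_sum_tendsto[of a, OF assms]])
  moreover have "radical_truncation a (Suc d) = 2 * sin (pi / 4 * signed_sum a 0 (Suc d))" for d
    using radical_tail_eq_sin[of a 0 d, OF assms] by (simp add: radical_truncation_def)
  \<comment> \<open>The angle is Q pi - pi/2, and sin (x - pi/2) = - cos x.\<close>
  moreover have "2 * sin (pi / 4 * (4 * binary_expansion a - 2))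
      = - 2 * cos (binary_expansion a * pi)"
    using sin_diff[of "binary_expansion a * pi" "pi / 2"] by (simp add: algebra_simps)
  ultimately have "(\<lambda>d. radical_truncation a (Suc d)) \<longlonglongrightarrow> - 2 * cos (binary_expansion a * pi)"
    by (simp only:)
  \<comment> \<open>The sine formula starts at one radical; dropping the junk value at index 0 does
    not affect the limit.\<close>
  then show ?thesis
    by (rule LIMSEQ_imp_Suc)
qed

end
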